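(* Let $m\ge 2$ be an odd integer, and let $Q_m$ be the Euler quotient function. Suppose that the function $n\mapsto Q_m(n)$ on the integers is $km$-periodic, where $k>3$ is an integer with $k\mid m$. Define the $km$-periodic binary sequence $(s_t)_{t\ge 0}$ by $$s_t=\begin{cases}0, & \text{if } 0\le \dfrac{Q_m(t)}{m}<\dfrac12,\\[2mm] 1, & \text{if } \dfrac12\le \dfrac{Q_m(t)}{m}<1.\end{cases}$$ Then $$\sum_{t=0}^{km-1}(-1)^{s_t+s_{t+m}+s_{t+2m}+s_{t+3m}}=km-\frac23\,k\,\phi(m)+O\left(\phi(m)\,\phi(k)^{-1}\,k^{3/2}(\log m)^4\right),$$ where the implied constant is absolute.
   Context: $\phi$ is Euler's totient function. For an odd integer $m\ge 2$ and an integer $n$ with $\gcd(n,m)=1$, the Euler quotient $Q_m(n)$ is the unique integer with $0\le Q_m(n)<m$ and $Q_m(n)\equiv \frac{n^{\phi(m)}-1}{m}\pmod m$; if $\gcd(n,m)>1$, then $Q_m(n)=0$. "$Q_m$ is $km$-periodic" means that $km$ is the least positive period of $Q_m$. An absolute implied constant does not depend on $m$ or $k$. *)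

theory Defs
  imports Complex_Main "HOL-Number_Theory.Number_Theory"
begin

text \<open>
  The Euler quotient modulo \<open>m\<close>.  The division by \<open>m\<close> is exact for \<open>n\<close> coprime to \<open>m\<close>
  by Euler's theorem; \<open>euler_quotient_unique\<close> below is the usual characterisation by a
  residue in \<open>{0..<m}\<close>.
\<close>

definition euler_quotient :: "nat \<Rightarrow> int \<Rightarrow> int" where
  "euler_quotient m n =
     (if coprime n (int m) then ((n ^ totient m - 1) div int m) mod int m else 0)"

definition least_period :: "(int \<Rightarrow> 'a) \<Rightarrow> nat \<Rightarrow> bool" where
  "least_period f p \<longleftrightarrow>
     0 < p \<and> (\<forall>n. f (n + int p) = f n) \<and>
     (\<forall>q. 0 < q \<and> (\<forall>n. f (n + int q) = f n) \<longrightarrow> p \<le> q)"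

definition euler_binary_seq :: "nat \<Rightarrow> nat \<Rightarrow> nat" where
  "euler_binary_seq m t =
     (if real_of_int (euler_quotient m (int t)) / real m < 1 / 2 then 0 else 1)"

lemma int_dvd_power_totient_minus_1:
  assumes "coprime n (int m)"
  shows "int m dvd n ^ totient m - 1"
proof (cases "m = 0")
  case True
  then show ?thesis by simp
next
  case False
  define a where "a = nat (n mod int m)"
  have a: "int a = n mod int m" using False by (simp add: a_def)
  have "coprime (int a) (int m)"
    unfolding a using assms False by (subst coprime_mod_left_iff) auto
  then have "coprime a m" by (simp only: coprime_int_iff)
  then have "[a ^ totient m = 1] (mod m)" by (rule euler_theorem)
  then have "[int (a ^ totient m) = int 1] (mod int m)" by (simp only: cong_int_iff)
  then have "[int a ^ totient m = 1] (mod int m)" by (simp only: of_nat_power of_nat_1)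
  moreover have "[n = int a] (mod int m)" unfolding a cong_def by (simp only: mod_mod_trivial)
  then have "[n ^ totient m = int a ^ totient m] (mod int m)" by (rule cong_pow)
  ultimately have "[n ^ totient m = 1] (mod int m)" by (rule cong_trans[rotated])
  then show ?thesis by (simp only: cong_iff_dvd_diff)
qed

lemma euler_quotient_unique:
  assumes "0 < m" "coprime n (int m)"
  shows "euler_quotient m n = q \<longleftrightarrow>
    0 \<le> q \<and> q < int m \<and>
    (\<exists>d. n ^ totient m - 1 = int m * d \<and> [q = d] (mod int m))"
proof -
  obtain d where d: "n ^ totient m - 1 = int m * d"
    using int_dvd_power_totient_minus_1[OF assms(2)] by (elim dvdE)
  have m: "int m \<noteq> 0" using assms(1) by simp
  have eq: "euler_quotient m n = d mod int m"
    unfolding euler_quotient_def d using assms(2) nonzero_mult_div_cancel_left[OF m, of d]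
    by (simp only: if_True)
  have uniq: "d' = d" if "n ^ totient m - 1 = int m * d'" for d'
    using that m unfolding d by (simp only: mult_cancel_left) blast
  show ?thesis
  proof
    assume "euler_quotient m n = q"
    then have q: "q = d mod int m" using eq by (simp only:)
    then have "0 \<le> q" "q < int m" "[q = d] (mod int m)"
      using assms(1) by (simp_all add: cong_def)
    with d show "0 \<le> q \<and> q < int m \<and>
        (\<exists>d. n ^ totient m - 1 = int m * d \<and> [q = d] (mod int m))" by blast
  next
    assume r: "0 \<le> q \<and> q < int m \<and>
        (\<exists>d. n ^ totient m - 1 = int m * d \<and> [q = d] (mod int m))"
    then have "[q = d] (mod int m)" using uniq by blast
    then show "euler_quotient m n = q" using r eq by (simp add: cong_def)
  qed
qed

end

theory Submission
  imports Defs
begin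

text \<open>
  Let \<open>w\<close> be the square wave of period 1 with the value 1 on \<open>[0, 1/2)\<close> and \<open>-1\<close> on \<open>[1/2, 1)\<close>, so
  that the sign attached to an index \<open>t\<close> is \<open>w (Q t / m)\<close> with \<open>Q\<close> the Euler quotient modulo \<open>m\<close>.
  If \<open>t\<close> is not coprime to \<open>m\<close>, all four signs of its summand are 1; these \<open>t\<close> contribute
  \<open>k * (m - \<phi> m)\<close> exactly.

  Expanding \<open>(n + m j) ^ \<phi> m\<close> modulo \<open>m\<^sup>2\<close> shows that \<open>Q (n + m j) = Q n + \<phi> m * n ^ (\<phi> m - 1) * j\<close>
  modulo \<open>m\<close> (\<open>euler_quotient_shift\<close>). Hence, if \<open>Q\<close> has least period \<open>k m\<close>, then
  \<open>\<phi> m / m = r / k\<close> with \<open>r\<close> coprime to \<open>k\<close> (\<open>euler_quotient_step\<close>). So for \<open>t\<close> coprime to \<open>m\<close>,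
  along \<open>t, t + m, t + 2 m, \<dots>\<close> the point \<open>Q / m\<close> moves on the circle by steps \<open>y = c / k\<close>, where
  \<open>c = r * t ^ (\<phi> m - 1)\<close> is \<open>r\<close> times the inverse of \<open>t\<close> and is coprime to \<open>k\<close>. It therefore
  visits each point \<open>x + j / k\<close> once, and the inner sum is
  \<open>\<Sum>j<k. w x\<^sub>j * w (x\<^sub>j + y) * w (x\<^sub>j + 2 y) * w (x\<^sub>j + 3 y)\<close> with \<open>x\<^sub>j = x + j / k\<close>.

  For fixed \<open>y\<close> the product is \<open>-1\<close> on at most four arcs and 1 elsewhere, so the sum is \<open>k\<close> times its mean
  \<open>F y\<close> over the circle, up to a bounded error, uniformly in the starting point \<open>x\<close>
  (\<open>sum_fourfold\<close>). The function \<open>F\<close> is continuous and piecewise linear, with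
  mean value \<open>1/3\<close>; this is the source of the constant \<open>- 2/3 = - 1 + 1/3\<close>. Being Lipschitz, \<open>F - 1/3\<close> has
  bounded sums over every regular grid (\<open>sum_fourfold_mean\<close>). The grid points with numerator coprime to
  \<open>k\<close> are reached by sieving with the primes dividing \<open>k\<close>; a bounded error in each of the
  \<open>2 ^ \<omega> k\<close> terms adds up to \<open>O(sqrt k)\<close> (\<open>sum_units_bound\<close>).

  Finally \<open>t \<mapsto> c\<close> maps the units modulo \<open>m\<close> onto the units modulo \<open>k\<close> with fibres of equal size
  \<open>\<phi> m / \<phi> k\<close> (\<open>sum_units_quotient\<close>), so the total error is
  \<open>O(\<phi> m) + k * (\<phi> m / \<phi> k) * O(sqrt k)\<close>, that is \<open>O((\<phi> m / \<phi> k) * k powr (3/2))\<close>. The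
  stated bound follows, because \<open>m \<ge> 3\<close> makes \<open>ln m \<ge> 1\<close>.
\<close>

section \<open>Products of four square waves\<close>

definition square_wave :: "real \<Rightarrow> real" where
  "square_wave x = (if frac x < 1 / 2 then 1 else - 1)"

definition fourfold :: "real \<Rightarrow> real \<Rightarrow> real" where
  "fourfold x y = square_wave x * square_wave (x + y) * square_wave (x + 2 * y)
     * square_wave (x + 3 * y)"

definition ramp :: "real \<Rightarrow> real \<Rightarrow> real" where
  "ramp c y = max 0 (y - c)"

text \<open>
  The mean of \<open>fourfold x y\<close> over one period in \<open>x\<close>, for \<open>0 \<le> y < 1\<close>. It interpolates linearly
  between the values 1 at \<open>0, 1/4, 1/2, 3/4, 1\<close> and \<open>- 1/3\<close> at \<open>1/6, 1/3, 2/3, 5/6\<close>; the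
  coefficients of the ramps are the jumps between the successive slopes
  \<open>- 8, 16, - 16, 8, - 8, 16, - 16, 8\<close>.
\<close>

definition fourfold_mean :: "real \<Rightarrow> real" where
  "fourfold_mean y = 1 - 8 * ramp 0 y + 24 * ramp (1/6) y - 32 * ramp (1/4) y + 24 * ramp (1/3) y
     - 16 * ramp (1/2) y + 24 * ramp (2/3) y - 32 * ramp (3/4) y + 24 * ramp (5/6) y"

lemma square_wave_shift_int [simp]: "square_wave (x + of_int n) = square_wave x"
  by (simp add: square_wave_def frac_def)

lemma square_wave_shift_half: "square_wave (x + 1 / 2) = - square_wave x"
proof -
  have "\<lfloor>x + 1 / 2\<rfloor> = (if frac x < 1 / 2 then \<lfloor>x\<rfloor> else \<lfloor>x\<rfloor> + 1)"
    unfolding frac_def by (simp add: floor_eq_iff) linarith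
  then have "frac (x + 1 / 2) = (if frac x < 1 / 2 then frac x + 1 / 2 else frac x - 1 / 2)"
    by (simp add: frac_def)
  then show ?thesis
    using frac_lt_1[of x] frac_ge_0[of x]
    by (cases "frac x < 1 / 2") (simp_all add: square_wave_def not_less)
qed

lemma square_wave_near:
  assumes "0 \<le> z" "z < 5 / 2"
  shows "square_wave z = (if z < 1/2 \<or> 1 \<le> z \<and> z < 3/2 \<or> 2 \<le> z then 1 else - 1)"
proof -
  have "\<lfloor>z\<rfloor> = (if z < 1 then 0 else if z < 2 then 1 else 2)"
    using assms by (auto simp: floor_eq_iff)
  then show ?thesis
    using assms by (auto simp: square_wave_def frac_def)
qed

lemma fourfold_shift_int: "fourfold (x + of_int n) y = fourfold x y"
  using square_wave_shift_int[of x n] square_wave_shift_int[of "x + y" n]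
    square_wave_shift_int[of "x + 2 * y" n] square_wave_shift_int[of "x + 3 * y" n]
  unfolding fourfold_def by (simp add: algebra_simps)

lemma fourfold_step_int: "fourfold x (y + of_int n) = fourfold x y"
  using square_wave_shift_int[of "x + y" n]
    square_wave_shift_int[of "x + 2 * y" "2 * n"] square_wave_shift_int[of "x + 3 * y" "3 * n"]
  unfolding fourfold_def by (simp add: algebra_simps)

text \<open>
  Only the second and the fourth factor change sign, because their arguments move by an odd multiple
  of \<open>1/2\<close>.
\<close>

lemma fourfold_step_half: "fourfold x (y + 1 / 2) = fourfold x y"
proof -
  have 1: "square_wave (x + (y + 1 / 2)) = - square_wave (x + y)"
    using square_wave_shift_half[of "x + y"] by (simp add: algebra_simps)
  have 2: "square_wave (x + 2 * (y + 1 / 2)) = square_wave (x + 2 * y)"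
    using square_wave_shift_int[of "x + 2 * y" 1] by (simp add: algebra_simps)
  have "x + 3 * (y + 1 / 2) = (x + 3 * y + 1 / 2) + of_int 1" by simp
  then have 3: "square_wave (x + 3 * (y + 1 / 2)) = - square_wave (x + 3 * y)"
    by (simp only: square_wave_shift_int square_wave_shift_half)
  show ?thesis
    unfolding fourfold_def 1 2 3 by simp
qed

text \<open>
  Hermite's identity. Pulling the floor inside the quotient reduces it to integers, where raising \<open>n\<close>
  by one drops \<open>n div k\<close> from the sum and adds \<open>(n + k) div k\<close>.
\<close>

lemma hermite_sum_floor:
  fixes k :: nat and x :: real
  assumes "0 < k"
  shows "(\<Sum>j<k. \<lfloor>x + real j / real k\<rfloor>) = \<lfloor>real k * x\<rfloor>"
proof -
  have sum_div: "(\<Sum>j<k. (n + int j) div int k) = n" for n :: int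
  proof -
    define S where "S n = (\<Sum>j<k. (n + int j) div int k)" for n
    have step: "S (n + 1) = S n + 1" for n
    proof -
      have "S (n + 1) + n div int k = (\<Sum>j<Suc k. (n + int j) div int k)"
        unfolding S_def by (subst sum.lessThan_Suc_shift) (simp add: algebra_simps)
      also have "\<dots> = S n + (n + int k) div int k"
        unfolding S_def by simp
      finally show ?thesis using assms by (simp add: div_add_self2)
    qed
    have "S 0 = 0" unfolding S_def by simp
    then have "S n = n"
    proof (induction n rule: int_induct[where k = 0])
      case (step2 i)
      then show ?case using step[of "i - 1"] by simp
    qed (simp_all add: step)
    then show ?thesis by (simp add: S_def)
  qed
  have "\<lfloor>x + real j / real k\<rfloor> = (\<lfloor>real k * x\<rfloor> + int j) div int k" for j
  proof -
    have "x + real j / real k = (real k * x + of_int (int j)) / of_int (int k)"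
      using assms by (simp add: field_simps)
    then show ?thesis
      by (simp only: floor_divide_real_eq_div of_nat_0_le_iff floor_add_int)
  qed
  then show ?thesis using sum_div by simp
qed

text \<open>
  The indicator function of the two arcs \<open>[a, b)\<close> and \<open>[a + 1/2, b + 1/2)\<close> of the circle, for
  \<open>0 \<le> a \<le> b \<le> 1/2\<close>. Floors make Hermite's identity applicable to it.
\<close>

definition arc_indicator :: "real \<Rightarrow> real \<Rightarrow> real \<Rightarrow> int" where
  "arc_indicator a b z = \<lfloor>z - a\<rfloor> - \<lfloor>z - b\<rfloor> + \<lfloor>z - 1 / 2 - a\<rfloor> - \<lfloor>z - 1 / 2 - b\<rfloor>"

lemma arc_indicator_shift_int: "arc_indicator a b (z + of_int n) = arc_indicator a b z"
proof -
  have *: "\<lfloor>z + of_int n - c\<rfloor> = \<lfloor>z - c\<rfloor> + n" for c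
    by (metis add_diff_eq diff_add_eq floor_add_int)
  have "z + of_int n - 1/2 - c = z + of_int n - (1/2 + c)" for c by simp
  then have "\<lfloor>z + of_int n - 1/2 - c\<rfloor> = \<lfloor>z - 1/2 - c\<rfloor> + n" for c
    using *[of "1/2 + c"] by (simp add: algebra_simps)
  then show ?thesis unfolding arc_indicator_def * by simp
qed

lemma arc_indicator_eq:
  assumes "0 \<le> a" "a \<le> b" "b \<le> 1 / 2" "0 \<le> z" "z < 1"
  shows "arc_indicator a b z = (if a \<le> z \<and> z < b \<or> a + 1/2 \<le> z \<and> z < b + 1/2 then 1 else 0)"
proof -
  have 1: "\<lfloor>z - c\<rfloor> = (if z < c then - 1 else 0)"
    and 2: "\<lfloor>z - 1/2 - c\<rfloor> = (if z < c + 1/2 then - 1 else 0)"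
    if "0 \<le> c" "c \<le> 1/2" for c
    using assms that by (auto simp: floor_eq_iff)
  show ?thesis
    unfolding arc_indicator_def using assms by (subst (1 2) 1; (subst (1 2) 2)?; auto)
qed

lemma sum_arc_indicator:
  fixes k :: nat
  assumes "0 < k"
  shows "\<bar>of_int (\<Sum>j<k. arc_indicator a b (x + real j / real k)) - 2 * real k * (b - a)\<bar> \<le> 2"
proof -
  have *: "(\<Sum>j<k. \<lfloor>x + real j / real k - c\<rfloor>) = \<lfloor>real k * (x - c)\<rfloor>" for c
    using hermite_sum_floor[OF assms, of "x - c"] by (simp add: algebra_simps)
  have "(\<Sum>j<k. arc_indicator a b (x + real j / real k))
      = \<lfloor>real k * (x - a)\<rfloor> - \<lfloor>real k * (x - b)\<rfloor>
        + \<lfloor>real k * (x - (1/2 + a))\<rfloor> - \<lfloor>real k * (x - (1/2 + b))\<rfloor>"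
    unfolding arc_indicator_def diff_diff_eq sum.distrib sum_subtractf * ..
  moreover have "real k * (x - a) - real k * (x - b) + real k * (x - (1/2 + a))
      - real k * (x - (1/2 + b)) = 2 * real k * (b - a)"
    by (simp add: algebra_simps)
  ultimately show ?thesis by linarith
qed

text \<open>
  If \<open>x \<mapsto> fourfold x y\<close> is \<open>-1\<close> on two arcs and their antipodes, then its mean is \<open>l\<close>, and the sum over \<open>k\<close> equally
  spaced points differs from \<open>k * l\<close> by twice the error of two arc counts.
\<close>

lemma sum_fourfold_of_arcs:
  fixes k :: nat
  assumes "0 < k"
    and "\<And>z. 0 \<le> z \<Longrightarrow> z < 1 \<Longrightarrow> fourfold z y = 1 - 2 * of_int (arc_indicator a b z + arc_indicator c d z)"
    and "l = 1 - 4 * (b - a + (d - c))"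
  shows "\<bar>(\<Sum>j<k. fourfold (x + real j / real k) y) - real k * l\<bar> \<le> 8"
proof -
  have *: "fourfold z y = 1 - 2 * of_int (arc_indicator a b z + arc_indicator c d z)" for z
    using assms(2)[of "frac z"] fourfold_shift_int[of "frac z" "\<lfloor>z\<rfloor>"]
      arc_indicator_shift_int[of _ _ "frac z" "\<lfloor>z\<rfloor>"] frac_lt_1[of z] frac_ge_0[of z]
    by (simp add: frac_def)
  define S T where "S = real_of_int (\<Sum>j<k. arc_indicator a b (x + real j / real k))"
    and "T = real_of_int (\<Sum>j<k. arc_indicator c d (x + real j / real k))"
  define u v where "u = 2 * real k * (b - a)" and "v = 2 * real k * (d - c)"
  have "(\<Sum>j<k. fourfold (x + real j / real k) y) = real k - 2 * (S + T)"
    unfolding * S_def T_def by (simp add: sum_subtractf sum.distrib sum_distrib_left algebra_simps)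
  moreover have "real k * l = real k - 2 * (u + v)"
    unfolding assms(3) u_def v_def by (simp add: algebra_simps)
  moreover have "\<bar>S - u\<bar> \<le> 2" "\<bar>T - v\<bar> \<le> 2"
    unfolding S_def T_def u_def v_def using sum_arc_indicator[OF assms(1)] by blast+
  ultimately have eq: "(\<Sum>j<k. fourfold (x + real j / real k) y) - real k * l
      = 2 * ((u + v) - (S + T))" and "\<bar>S - u\<bar> \<le> 2" "\<bar>T - v\<bar> \<le> 2"
    by simp_all
  then have "\<bar>(u + v) - (S + T)\<bar> \<le> 4" by linarith
  then show ?thesis unfolding eq abs_mult by simp
qed

text \<open>
  On \<open>0 \<le> x < 1/2\<close> the factors change sign at the points of \<open>- y, - 2 y, - 3 y\<close> modulo \<open>1/2\<close>. Their
  order is constant for \<open>y\<close> between consecutive points of \<open>0, 1/6, 1/4, 1/3, 1/2\<close>, and in each of these four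
  ranges they cut out two arcs on which the product is negative. The pattern repeats in
  \<open>1/2 \<le> x < 1\<close>, since all four factors change sign there.
\<close>

lemma sum_fourfold_half:
  fixes k :: nat
  assumes "0 < k" "0 \<le> y" "y < 1/2"
  shows "\<bar>(\<Sum>j<k. fourfold (x + real j / real k) y) - real k * fourfold_mean y\<bar> \<le> 8"
proof -
  have sw: "fourfold z y =
      (if z < 1/2 then 1 else - 1) *
      (if z + y < 1/2 \<or> 1 \<le> z + y then 1 else - 1) *
      (if z + 2 * y < 1/2 \<or> 1 \<le> z + 2 * y \<and> z + 2 * y < 3/2 then 1 else - 1) *
      (if z + 3 * y < 1/2 \<or> 1 \<le> z + 3 * y \<and> z + 3 * y < 3/2 \<or> 2 \<le> z + 3 * y then 1 else - 1)"
    if "0 \<le> z" "z < 1" for z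
  proof -
    have "square_wave z = (if z < 1/2 then 1 else - 1)"
      and "square_wave (z + y) = (if z + y < 1/2 \<or> 1 \<le> z + y then 1 else - 1)"
      and "square_wave (z + 2 * y)
        = (if z + 2 * y < 1/2 \<or> 1 \<le> z + 2 * y \<and> z + 2 * y < 3/2 then 1 else - 1)"
      and "square_wave (z + 3 * y)
        = (if z + 3 * y < 1/2 \<or> 1 \<le> z + 3 * y \<and> z + 3 * y < 3/2 \<or> 2 \<le> z + 3 * y then 1 else - 1)"
      using assms that by (simp_all add: square_wave_near)
    then show ?thesis unfolding fourfold_def by (simp only:)
  qed
  consider "y \<le> 1/6" | "1/6 \<le> y" "y \<le> 1/4" | "1/4 \<le> y" "y \<le> 1/3" | "1/3 \<le> y" by linarith
  then show ?thesis
  proof cases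
    case 1
    show ?thesis
    proof (rule sum_fourfold_of_arcs[where a = "1/2 - 3 * y" and b = "1/2 - 2 * y"
          and c = "1/2 - y" and d = "1/2", OF assms(1)])
      show "fourfold z y = 1 - 2 * of_int (arc_indicator (1/2 - 3 * y) (1/2 - 2 * y) z
          + arc_indicator (1/2 - y) (1/2) z)" if "0 \<le> z" "z < 1" for z
        using assms 1 that by (simp add: sw arc_indicator_eq)
    qed (use assms 1 in \<open>simp add: fourfold_mean_def ramp_def\<close>)
  next
    case 2
    show ?thesis
    proof (rule sum_fourfold_of_arcs[where a = "0" and b = "1/2 - 2 * y"
          and c = "1/2 - y" and d = "1 - 3 * y", OF assms(1)])
      show "fourfold z y = 1 - 2 * of_int (arc_indicator 0 (1/2 - 2 * y) z
          + arc_indicator (1/2 - y) (1 - 3 * y) z)" if "0 \<le> z" "z < 1" for z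
        using assms 2 that by (simp add: sw arc_indicator_eq)
    qed (use assms 2 in \<open>simp add: fourfold_mean_def ramp_def\<close>)
  next
    case 3
    show ?thesis
    proof (rule sum_fourfold_of_arcs[where a = "1 - 3 * y" and b = "1/2 - y"
          and c = "1 - 2 * y" and d = "1/2", OF assms(1)])
      show "fourfold z y = 1 - 2 * of_int (arc_indicator (1 - 3 * y) (1/2 - y) z
          + arc_indicator (1 - 2 * y) (1/2) z)" if "0 \<le> z" "z < 1" for z
        using assms 3 that by (simp add: sw arc_indicator_eq)
    qed (use assms 3 in \<open>simp add: fourfold_mean_def ramp_def\<close>)
  next
    case 4
    show ?thesis
    proof (rule sum_fourfold_of_arcs[where a = "0" and b = "1/2 - y"
          and c = "1 - 2 * y" and d = "3/2 - 3 * y", OF assms(1)])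
      show "fourfold z y = 1 - 2 * of_int (arc_indicator 0 (1/2 - y) z
          + arc_indicator (1 - 2 * y) (3/2 - 3 * y) z)" if "0 \<le> z" "z < 1" for z
        using assms 4 that by (simp add: sw arc_indicator_eq)
    qed (use assms 4 in \<open>simp add: fourfold_mean_def ramp_def\<close>)
  qed
qed

lemma sum_fourfold:
  fixes k :: nat
  assumes "0 < k" "0 \<le> y" "y < 1"
  shows "\<bar>(\<Sum>j<k. fourfold (x + real j / real k) y) - real k * fourfold_mean y\<bar> \<le> 8"
proof (cases "y < 1/2")
  case True
  then show ?thesis using sum_fourfold_half assms by blast
next
  case False
  have "fourfold_mean y = fourfold_mean (y - 1/2)"
  proof -
    consider "y \<le> 2/3" | "2/3 \<le> y" "y \<le> 3/4" | "3/4 \<le> y" "y \<le> 5/6" | "5/6 \<le> y" by linarith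
    then show ?thesis using False assms by cases (simp_all add: fourfold_mean_def ramp_def)
  qed
  moreover have "fourfold z y = fourfold z (y - 1/2)" for z
    using fourfold_step_half[of z "y - 1/2"] by simp
  ultimately show ?thesis using sum_fourfold_half[of k "y - 1/2" x] False assms by simp
qed

text \<open>
  A Riemann sum for \<open>\<integral> ramp c = (1 - c)\<^sup>2 / 2\<close> over \<open>[0, 1]\<close>. With step \<open>h = 1 / N\<close>, the increments of the antiderivative
  \<open>(ramp c)\<^sup>2 / 2\<close> lie between \<open>h * ramp c\<close> and \<open>h * ramp c + h\<^sup>2\<close>, and they telescope.
\<close>

lemma sum_ramp:
  assumes "0 < N" "0 \<le> c" "c \<le> 1"
  shows "\<bar>(\<Sum>b<N. ramp c (real b / real N)) - real N * (1 - c)\<^sup>2 / 2\<bar> \<le> 1"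
proof -
  define h where "h = 1 / real N"
  have h: "0 < h" "real N * h = 1" using assms by (simp_all add: h_def)
  define G where "G j = (ramp c (real j * h))\<^sup>2 / 2" for j
  have tele: "(\<Sum>j<N. G (Suc j) - G j) = (1 - c)\<^sup>2 / 2"
    using assms h unfolding sum_lessThan_telescope by (simp add: G_def ramp_def)
  have step: "h * ramp c (real j * h) \<le> G (Suc j) - G j \<and>
      G (Suc j) - G j \<le> h * ramp c (real j * h) + h\<^sup>2" for j
  proof -
    define p where "p = ramp c (real j * h)"
    define q where "q = ramp c (real (Suc j) * h)"
    consider "p = 0" "0 \<le> q" "q \<le> h" | "q = p + h" "0 \<le> p"
    proof (cases "real j * h \<le> c")
      case True
      then show ?thesis using h that by (simp add: p_def q_def ramp_def distrib_right)
    next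
      case False
      then show ?thesis using h that by (simp add: p_def q_def ramp_def distrib_right)
    qed
    then have "h * p \<le> (q\<^sup>2 - p\<^sup>2) / 2 \<and> (q\<^sup>2 - p\<^sup>2) / 2 \<le> h * p + h\<^sup>2"
    proof cases
      case 1
      then have "q\<^sup>2 \<le> h\<^sup>2" by (intro power_mono)
      with 1 show ?thesis using zero_le_power2[of q] zero_le_power2[of h] by (simp; linarith)
    next
      case 2
      then show ?thesis using h by (simp add: power2_eq_square algebra_simps)
    qed
    then show ?thesis by (simp add: G_def p_def q_def diff_divide_distrib)
  qed
  define S where "S = (\<Sum>b<N. ramp c (real b * h))"
  have lo: "h * S \<le> (1 - c)\<^sup>2 / 2"
    unfolding tele[symmetric] S_def sum_distrib_left using step by (intro sum_mono) auto
  have "(1 - c)\<^sup>2 / 2 \<le> (\<Sum>b<N. h * ramp c (real b * h) + h\<^sup>2)"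
    unfolding tele[symmetric] using step by (intro sum_mono) auto
  also have "\<dots> = h * S + real N * h\<^sup>2"
    by (simp add: S_def sum.distrib sum_distrib_left)
  finally have hi: "(1 - c)\<^sup>2 / 2 \<le> h * S + h"
    using h by (simp add: power2_eq_square flip: mult.assoc)
  have hS: "real N * (h * S) = S" using h by (simp flip: mult.assoc)
  have "S \<le> real N * ((1 - c)\<^sup>2 / 2)"
    using mult_left_mono[OF lo, of "real N"] hS by simp
  moreover have "real N * ((1 - c)\<^sup>2 / 2) \<le> S + 1"
    using mult_left_mono[OF hi, of "real N"] hS h by (simp add: distrib_left)
  moreover have "(\<Sum>b<N. ramp c (real b / real N)) = S"
    by (simp add: S_def h_def)
  ultimately show ?thesis by simp
qed

text \<open>
  The mean of \<open>fourfold_mean\<close> is \<open>1/3\<close>, and 184 is the sum of the absolute values of its ramp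
  coefficients.
\<close>

lemma sum_fourfold_mean:
  assumes "0 < N"
  shows "\<bar>\<Sum>b<N. fourfold_mean (real b / real N) - 1/3\<bar> \<le> 184"
proof -
  define err where "err c = (\<Sum>b<N. ramp c (real b / real N)) - real N * (1 - c)\<^sup>2 / 2" for c
  have sum_eq: "(\<Sum>b<N. ramp c (real b / real N)) = err c + real N * (1 - c)\<^sup>2 / 2" for c
    by (simp add: err_def)
  have err: "- 1 \<le> err c" "err c \<le> 1" if "0 \<le> c" "c \<le> 1" for c
    using sum_ramp[OF assms that] by (simp_all add: err_def abs_le_iff)
  have eq: "(\<Sum>b<N. fourfold_mean (real b / real N) - 1/3) = - 8 * err 0 + 24 * err (1/6)
      - 32 * err (1/4) + 24 * err (1/3) - 16 * err (1/2) + 24 * err (2/3) - 32 * err (3/4) + 24 * err (5/6)"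
    unfolding fourfold_mean_def sum.distrib sum_subtractf sum_distrib_left[symmetric] sum_eq
    by (simp add: power2_eq_square)
  have bounds: "- 1 \<le> err 0" "err 0 \<le> 1" "- 1 \<le> err (1/6)" "err (1/6) \<le> 1"
    "- 1 \<le> err (1/4)" "err (1/4) \<le> 1" "- 1 \<le> err (1/3)" "err (1/3) \<le> 1"
    "- 1 \<le> err (1/2)" "err (1/2) \<le> 1" "- 1 \<le> err (2/3)" "err (2/3) \<le> 1"
    "- 1 \<le> err (3/4)" "err (3/4) \<le> 1" "- 1 \<le> err (5/6)" "err (5/6) \<le> 1"
    by (rule err; simp)+
  show ?thesis
    unfolding eq by (rule abs_leI) (use bounds in linarith)+
qed

section \<open>Sums over numerators coprime to the denominator\<close>

lemma common_prime_divisor: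
  fixes a b :: nat
  assumes "\<not> coprime a b"
  obtains p where "prime p" "p dvd a" "p dvd b"
proof -
  from assms obtain c where c: "c dvd a" "c dvd b" "\<not> is_unit c" by (rule not_coprimeE)
  then obtain p where "prime p" "p dvd c" using prime_factor_nat[of c] by auto
  with c that show ?thesis by (meson dvd_trans)
qed

text \<open>
  Sieving by one more prime \<open>p\<close> removes the terms with \<open>a = p * b\<close>, and these form the sieved sum
  for the denominator \<open>n / p\<close>, because \<open>g\<close> depends on the fraction only. So each prime at most
  doubles the bound.
\<close>

lemma sieve_bound:
  fixes g :: "real \<Rightarrow> real"
  assumes g: "\<And>N. 0 < N \<Longrightarrow> \<bar>\<Sum>b<N. g (real b / real N)\<bar> \<le> C"
    and "finite P" "\<And>p. p \<in> P \<Longrightarrow> prime p" "0 < q" "n = q * \<Prod>P"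
  shows "\<bar>\<Sum>a | a < n \<and> (\<forall>p\<in>P. \<not> p dvd a). g (real a / real n)\<bar> \<le> C * 2 ^ card P"
  using assms(2-)
proof (induction P arbitrary: q n rule: finite_induct)
  case empty
  then show ?case using g[of n] by (simp add: lessThan_def)
next
  case (insert p P)
  define A where "A n = {a. a < n \<and> (\<forall>r\<in>P. \<not> r dvd a)}" for n :: nat
  define n' where "n' = q * \<Prod>P"
  have p: "prime p" "0 < p" using insert.prems prime_gt_0_nat by auto
  have n: "n = p * n'" using insert.hyps insert.prems by (simp add: n'_def)
  have fin: "finite (A n)" for n by (simp add: A_def)
  have dvd_iff: "r dvd p * b \<longleftrightarrow> r dvd b" if "r \<in> P" for r b
    using that insert.hyps insert.prems p
    by (metis dvd_mult insert_iff prime_dvd_mult_iff primes_dvd_imp_eq)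
  have multiples: "{a \<in> A n. p dvd a} = (*) p ` A n'"
  proof -
    have "p * b \<in> A n \<longleftrightarrow> b \<in> A n'" for b
      using p by (simp add: A_def n dvd_iff)
    then show ?thesis by (auto elim!: dvdE)
  qed
  have "(\<Sum>a | a < n \<and> (\<forall>r\<in>insert p P. \<not> r dvd a). g (real a / real n))
      = (\<Sum>a \<in> A n - {a \<in> A n. p dvd a}. g (real a / real n))"
    by (intro sum.cong) (auto simp: A_def)
  also have "\<dots> = (\<Sum>a\<in>A n. g (real a / real n)) - (\<Sum>a | a \<in> A n \<and> p dvd a. g (real a / real n))"
    by (intro sum_diff fin) auto
  also have "(\<Sum>a | a \<in> A n \<and> p dvd a. g (real a / real n)) = (\<Sum>b\<in>A n'. g (real b / real n'))"
    unfolding multiples using p by (subst sum.reindex) (auto simp: inj_on_def n)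
  finally have "(\<Sum>a | a < n \<and> (\<forall>r\<in>insert p P. \<not> r dvd a). g (real a / real n))
      = (\<Sum>a\<in>A n. g (real a / real n)) - (\<Sum>b\<in>A n'. g (real b / real n'))" .
  moreover have "\<bar>\<Sum>a\<in>A n. g (real a / real n)\<bar> \<le> C * 2 ^ card P"
    unfolding A_def using insert.prems p n by (intro insert.IH[of "p * q"]) (auto simp: n'_def)
  moreover have "\<bar>\<Sum>a\<in>A n'. g (real a / real n')\<bar> \<le> C * 2 ^ card P"
    unfolding A_def using insert.prems by (intro insert.IH[of q]) (auto simp: n'_def)
  ultimately show ?case using insert.hyps by simp
qed

text \<open>
  Every element but 3 is at least 4; the factor 2 makes up for the 3.
\<close>

lemma four_power_card_le_prod:
  fixes P :: "nat set"
  assumes "finite P" "\<And>p. p \<in> P \<Longrightarrow> 3 \<le> p"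
  shows "4 ^ card P \<le> 2 * \<Prod>P"
proof -
  have large: "4 ^ card Q \<le> \<Prod>Q" if "finite Q" "\<And>p. p \<in> Q \<Longrightarrow> 4 \<le> p" for Q :: "nat set"
    using prod_mono[of Q "\<lambda>_. 4" "\<lambda>p. p"] that by simp
  show ?thesis
  proof (cases "3 \<in> P")
    case True
    have "4 ^ card (P - {3}) \<le> \<Prod>(P - {3})"
    proof (rule large)
      fix p assume "p \<in> P - {3}"
      then show "4 \<le> p" using assms(2)[of p] by simp
    qed (use assms in simp)
    moreover have "\<Prod>P = 3 * \<Prod>(P - {3})"
      using True assms(1) by (simp add: prod.remove)
    moreover have "card P = Suc (card (P - {3}))"
      using True assms(1) by (simp only: card_Suc_Diff1)
    ultimately show ?thesis by simp
  next
    case False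
    have "4 \<le> p" if "p \<in> P" for p
    proof -
      have "p \<noteq> 3" using False that by auto
      with assms(2)[OF that] show ?thesis by simp
    qed
    with assms(1) large[of P] show ?thesis by simp
  qed
qed

definition units_below :: "nat \<Rightarrow> nat set" where
  "units_below n = {a. a < n \<and> coprime a n}"

lemma finite_units_below [simp]: "finite (units_below n)"
  by (simp add: units_below_def)

lemma card_units_below: "1 < n \<Longrightarrow> card (units_below n) = totient n"
  unfolding totient_def
  by (rule arg_cong[where f = card])
    (use totatives_less in \<open>auto simp: units_below_def in_totatives_iff intro!: Nat.gr0I\<close>)

text \<open>
  Coprimality to \<open>n\<close> is sieved out by the prime factors of \<open>n\<close>. They are at least 3 because \<open>n\<close> is odd,
  and their product is at most \<open>n\<close>, so \<open>2 ^ \<omega> n\<close> is at most \<open>sqrt (2 n)\<close>.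
\<close>

lemma sum_units_bound:
  fixes g :: "real \<Rightarrow> real"
  assumes g: "\<And>N. 0 < N \<Longrightarrow> \<bar>\<Sum>b<N. g (real b / real N)\<bar> \<le> C"
    and "odd n"
  shows "\<bar>\<Sum>a\<in>units_below n. g (real a / real n)\<bar> \<le> C * sqrt (2 * real n)"
proof -
  have n: "0 < n" using \<open>odd n\<close> by (rule odd_pos)
  have C: "0 \<le> C" using g[of 1] by simp
  define P where "P = prime_factors n"
  have P: "finite P" "\<And>p. p \<in> P \<Longrightarrow> prime p" by (auto simp: P_def)
  have ge3: "3 \<le> p" if "p \<in> P" for p
  proof -
    have "p \<noteq> 2" using that \<open>odd n\<close> by (auto simp: P_def)
    with P(2)[OF that] prime_ge_2_nat[of p] show ?thesis by simp
  qed
  have "\<Prod>P dvd n"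
  proof -
    have "prod_mset (mset_set P) dvd prod_mset (prime_factorization n)"
      unfolding P_def by (intro prod_mset_subset_imp_dvd mset_set_set_mset_msubset)
    then show ?thesis using n by (simp add: prod_unfold_prod_mset prod_mset_prime_factorization_nat)
  qed
  then obtain q where q: "n = q * \<Prod>P" by (metis dvdE mult.commute)
  with n have q0: "0 < q" by (cases q) auto
  have "(\<forall>p\<in>P. \<not> p dvd a) \<longleftrightarrow> coprime a n" for a
  proof
    assume no_dvd: "\<forall>p\<in>P. \<not> p dvd a"
    show "coprime a n"
    proof (rule ccontr)
      assume "\<not> coprime a n"
      then obtain p where "prime p" "p dvd a" "p dvd n"
        by (rule common_prime_divisor)
      with no_dvd n show False by (auto simp: P_def prime_factors_dvd)
    qed
  next
    assume "coprime a n"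
    show "\<forall>p\<in>P. \<not> p dvd a"
    proof
      fix p assume "p \<in> P"
      then have "p dvd n" "prime p" by (auto simp: P_def)
      with \<open>coprime a n\<close> show "\<not> p dvd a" by (meson coprime_common_divisor not_prime_unit)
    qed
  qed
  then have "units_below n = {a. a < n \<and> (\<forall>p\<in>P. \<not> p dvd a)}"
    by (simp add: units_below_def)
  then have "\<bar>\<Sum>a\<in>units_below n. g (real a / real n)\<bar> \<le> C * 2 ^ card P"
    using sieve_bound[of g C P q n] g P q0 q by simp
  also have "2 ^ card P \<le> sqrt (2 * real n)"
  proof (rule real_le_rsqrt)
    have "4 ^ card P \<le> 2 * \<Prod>P" using four_power_card_le_prod P ge3 by blast
    also have "\<dots> \<le> 2 * n" using q q0 by simp
    finally have "real (4 ^ card P) \<le> real (2 * n)" by (simp only: of_nat_le_iff)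
    moreover have "(2 ^ card P)\<^sup>2 = (4 :: real) ^ card P"
      by (simp add: power2_eq_square flip: power_mult_distrib)
    ultimately show "(2 ^ card P)\<^sup>2 \<le> 2 * real n" by simp
  qed
  finally show ?thesis using C by (simp add: mult_left_mono)
qed

lemma sum_reindex_mult_mod:
  fixes h :: "nat \<Rightarrow> 'a :: comm_monoid_add"
  assumes "coprime c n" "0 < n"
  shows "(\<Sum>l<n. h ((c * l) mod n)) = (\<Sum>j<n. h j)"
    and "(\<Sum>l\<in>units_below n. h ((c * l) mod n)) = (\<Sum>j\<in>units_below n. h j)"
proof -
  have inj: "inj_on (\<lambda>l. (c * l) mod n) {..<n}"
  proof (rule inj_onI)
    fix x y assume xy: "x \<in> {..<n}" "y \<in> {..<n}" "(c * x) mod n = (c * y) mod n"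
    then have "[x = y] (mod n)"
      using assms(1) cong_mult_lcancel_nat unfolding cong_def by blast
    with xy show "x = y" by (simp add: cong_def)
  qed
  have *: "(\<Sum>l\<in>A. h ((c * l) mod n)) = (\<Sum>j\<in>A. h j)"
    if "A \<subseteq> {..<n}" "\<And>l. l \<in> A \<Longrightarrow> (c * l) mod n \<in> A" for A
  proof -
    have "bij_betw (\<lambda>l. (c * l) mod n) A A"
      unfolding bij_betw_def using that inj
      by (metis (no_types, lifting) endo_inj_surj finite_lessThan finite_subset image_subsetI inj_on_subset)
    then show ?thesis by (rule sum.reindex_bij_betw)
  qed
  show "(\<Sum>l<n. h ((c * l) mod n)) = (\<Sum>j<n. h j)"
    using assms by (intro *) auto
  show "(\<Sum>l\<in>units_below n. h ((c * l) mod n)) = (\<Sum>j\<in>units_below n. h j)"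
    using assms by (intro *) (auto simp: units_below_def)
qed

text \<open>
  Units modulo a divisor lift to units: the number \<open>a + k * s\<close> works, where \<open>s\<close> is the product of the primes
  that divide \<open>m\<close> but not \<open>a\<close>, because each prime divisor of \<open>m\<close> divides exactly one of \<open>a\<close> and \<open>k * s\<close>.
\<close>

lemma unit_lift:
  fixes a k m :: nat
  assumes "coprime a k" "k dvd m" "0 < m"
  shows "\<exists>u. coprime u m \<and> [u = a] (mod k)"
proof -
  define s where "s = \<Prod>{p \<in> prime_factors m. \<not> p dvd a}"
  have "coprime (a + k * s) m"
  proof (rule ccontr)
    assume "\<not> coprime (a + k * s) m"
    then obtain p where p: "prime p" "p dvd a + k * s" "p dvd m"
      by (rule common_prime_divisor)
    show False
    proof (cases "p dvd a")
      case True
      then have "p dvd k * s" using p(2) by (simp add: dvd_add_right_iff)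
      then consider "p dvd k" | "p dvd s" using p(1) prime_dvd_mult_iff by blast
      then show False
      proof cases
        case 1
        with True assms(1) p(1) show False
          by (meson coprime_common_divisor not_prime_unit)
      next
        case 2
        then obtain r where r: "r \<in> prime_factors m" "\<not> r dvd a" "p dvd r"
          unfolding s_def using p(1) by (auto simp: prime_dvd_prod_iff)
        then have "p = r" using p(1) by (auto intro: primes_dvd_imp_eq)
        with True r show False by simp
      qed
    next
      case False
      then have "p dvd s"
        unfolding s_def using p assms(3) by (intro dvd_prodI) (auto simp: prime_factors_dvd)
      with p(2) False show False by (simp add: dvd_add_left_iff)
    qed
  qed
  moreover have "[a + k * s = a] (mod k)" by (simp add: cong_def)
  ultimately show ?thesis by blast
qed

text \<open>
  Since \<open>t ^ (totient m - 1)\<close> inverts \<open>t\<close> modulo \<open>m\<close>, the argument of \<open>h\<close> runs through the units modulo \<open>k\<close>, and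
  each is taken equally often. Counting fibres is avoided by averaging: replacing \<open>t\<close> by \<open>v * t\<close> for a
  unit \<open>v\<close> permutes the units, and suitable \<open>v\<close> multiply the argument of \<open>h\<close> by any given unit \<open>a\<close>.
  Summing over all \<open>a\<close> first makes the inner sum independent of \<open>t\<close>.
\<close>

lemma sum_units_quotient:
  fixes h :: "nat \<Rightarrow> real"
  assumes "k dvd m" "1 < k" "0 < m" "coprime r k"
  shows "real (totient k) * (\<Sum>t\<in>units_below m. h ((r * t ^ (totient m - 1)) mod k))
    = real (totient m) * (\<Sum>a\<in>units_below k. h a)"
proof -
  have m: "1 < m" using dvd_imp_le[OF assms(1,3)] assms(2) by simp
  define e where "e = totient m - 1"
  have Suc_e: "Suc e = totient m" using assms(3) by (simp add: e_def)
  define T where "T = (\<Sum>t\<in>units_below m. h ((r * t ^ e) mod k))"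
  have twist: "T = (\<Sum>t\<in>units_below m. h (((r * t ^ e) * a) mod k))" if "a \<in> units_below k" for a
  proof -
    obtain u where u: "coprime u m" "[u = a] (mod k)"
      using unit_lift[OF _ assms(1,3), of a] \<open>a \<in> units_below k\<close> by (auto simp: units_below_def)
    \<comment> \<open>\<open>v\<close> is the inverse of a lift of \<open>a\<close>, so that \<open>v ^ e\<close> is that lift again.\<close>
    define v where "v = u ^ e"
    have v: "coprime v m" using u(1) by (simp add: v_def)
    have "[v ^ e = a] (mod k)"
    proof -
      have "[v * v ^ e = 1] (mod m)"
        using euler_theorem[OF v] by (simp flip: Suc_e)
      moreover have "[v * u = 1] (mod m)"
        using euler_theorem[OF u(1)] by (simp add: v_def mult.commute flip: Suc_e)
      ultimately have "[v * v ^ e = v * u] (mod m)" by (metis cong_sym cong_trans)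
      then have "[v ^ e = u] (mod m)" using v cong_mult_lcancel_nat by blast
      then have "[v ^ e = u] (mod k)" using assms(1) cong_dvd_modulus_nat by blast
      with u(2) show ?thesis using cong_trans by blast
    qed
    then have twisted: "(r * ((v * t) mod m) ^ e) mod k = ((r * t ^ e) * a) mod k" for t
    proof -
      have "[(v * t) mod m = v * t] (mod k)"
        using assms(1) by (metis cong_def mod_mod_cancel)
      then have "[((v * t) mod m) ^ e = (v * t) ^ e] (mod k)" by (rule cong_pow)
      also have "(v * t) ^ e = v ^ e * t ^ e" by (rule power_mult_distrib)
      also have "[v ^ e * t ^ e = a * t ^ e] (mod k)"
        using \<open>[v ^ e = a] (mod k)\<close> by (rule cong_scalar_right)
      finally have "[r * ((v * t) mod m) ^ e = r * (a * t ^ e)] (mod k)"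
        by (rule cong_scalar_left)
      then show ?thesis by (simp add: cong_def ac_simps)
    qed
    have "T = (\<Sum>t\<in>units_below m. h ((r * ((v * t) mod m) ^ e) mod k))"
      unfolding T_def
      by (rule sum_reindex_mult_mod(2)[OF v assms(3), of "\<lambda>t. h ((r * t ^ e) mod k)", symmetric])
    then show ?thesis by (simp only: twisted)
  qed
  have "real (totient k) * T = (\<Sum>a\<in>units_below k. T)"
    using card_units_below[OF assms(2)] by simp
  also have "\<dots> = (\<Sum>a\<in>units_below k. \<Sum>t\<in>units_below m. h (((r * t ^ e) * a) mod k))"
    by (intro sum.cong refl twist)
  also have "\<dots> = (\<Sum>t\<in>units_below m. \<Sum>a\<in>units_below k. h (((r * t ^ e) * a) mod k))"
    by (rule sum.swap)
  also have "\<dots> = (\<Sum>t\<in>units_below m. \<Sum>a\<in>units_below k. h a)"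
  proof (rule sum.cong[OF refl])
    fix t assume "t \<in> units_below m"
    then have "coprime t m" by (simp add: units_below_def)
    then have "coprime t k" using coprime_divisors[OF dvd_refl assms(1)] by blast
    then have "coprime (r * t ^ e) k" using assms(4) by simp
    then show "(\<Sum>a\<in>units_below k. h (((r * t ^ e) * a) mod k)) = (\<Sum>a\<in>units_below k. h a)"
      using assms(2) by (intro sum_reindex_mult_mod(2)) simp_all
  qed
  finally show ?thesis
    using card_units_below[OF m] by (simp add: T_def e_def)
qed

section \<open>The Euler quotient along arithmetic progressions\<close>

lemma power_add_cong_square:
  fixes a b :: int
  shows "\<exists>z. (a + b) ^ p = a ^ p + int p * a ^ (p - 1) * b + b\<^sup>2 * z"
proof (induction p)
  case 0
  show ?case by (rule exI[of _ 0]) simp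
next
  case (Suc p)
  then obtain z where z: "(a + b) ^ p = a ^ p + int p * a ^ (p - 1) * b + b\<^sup>2 * z" by blast
  have a: "int p * (a * a ^ (p - 1)) = int p * a ^ p" by (cases p) auto
  have "(a + b) ^ Suc p = a ^ Suc p + (int p * (a * a ^ (p - 1)) + a ^ p) * b
      + b\<^sup>2 * (z * (a + b) + int p * a ^ (p - 1))"
    by (simp add: z power2_eq_square algebra_simps)
  then have "(a + b) ^ Suc p = a ^ Suc p + int (Suc p) * a ^ (Suc p - 1) * b
      + b\<^sup>2 * (z * (a + b) + int p * a ^ (p - 1))"
    unfolding a by (simp add: algebra_simps)
  then show ?case by blast
qed

lemma coprime_add_multiple_iff:
  fixes n m :: "'a :: semiring_gcd"
  shows "coprime (n + j * m) m \<longleftrightarrow> coprime n m"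
  by (metis add.commute coprime_iff_gcd_eq_1 gcd.commute gcd_add_mult)

lemma euler_quotient_shift:
  assumes "0 < m" "coprime n (int m)"
  shows "euler_quotient m (n + int m * j)
    = (euler_quotient m n + int (totient m) * n ^ (totient m - 1) * j) mod int m"
proof -
  obtain d where d: "n ^ totient m - 1 = int m * d"
    using int_dvd_power_totient_minus_1[OF assms(2)] by (elim dvdE)
  obtain z where z: "(n + int m * j) ^ totient m = n ^ totient m
      + int (totient m) * n ^ (totient m - 1) * (int m * j) + (int m * j)\<^sup>2 * z"
    using power_add_cong_square by blast
  have "(n + int m * j) ^ totient m - 1
      = int m * (d + int (totient m) * n ^ (totient m - 1) * j + int m * (j\<^sup>2 * z))"
  proof -
    have "(n + int m * j) ^ totient m - 1 = (n ^ totient m - 1)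
        + int (totient m) * n ^ (totient m - 1) * (int m * j) + (int m * j)\<^sup>2 * z"
      using z by simp
    then show ?thesis unfolding d by (simp add: power2_eq_square algebra_simps)
  qed
  moreover have "coprime (n + int m * j) (int m)"
    using assms(2) coprime_add_multiple_iff[of n j "int m"] by (simp add: mult.commute)
  ultimately show ?thesis
    using assms d by (simp add: euler_quotient_def mod_simps)
qed

lemma euler_quotient_not_coprime: "\<not> coprime n (int m) \<Longrightarrow> euler_quotient m n = 0"
  by (simp add: euler_quotient_def)

text \<open>
  The period \<open>k * m\<close>, applied at \<open>n = 1\<close>, forces \<open>m\<close> to divide \<open>totient m * k\<close>. A common factor \<open>g\<close> of \<open>r\<close> and
  \<open>k\<close> could be cancelled from this equation and would make \<open>(k / g) * m\<close> a period.
\<close>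

lemma euler_quotient_step:
  assumes "0 < m" "k dvd m" "least_period (euler_quotient m) (k * m)"
  obtains r where "totient m * k = r * m" "coprime r k"
proof -
  have k: "0 < k" using assms by (auto intro: Nat.gr0I)
  have "euler_quotient m (1 + int (k * m)) = euler_quotient m 1"
    using assms(3) unfolding least_period_def by blast
  moreover have "euler_quotient m 1 = 0" by (simp add: euler_quotient_def)
  ultimately have "int (totient m) * int k mod int m = 0"
    using euler_quotient_shift[OF assms(1), of 1 "int k"] by (simp add: mult.commute)
  then have "int m dvd int (totient m * k)" by (simp add: mod_eq_0_iff_dvd)
  then have "m dvd totient m * k" by (simp only: of_nat_dvd_iff)
  then obtain r where r: "totient m * k = r * m" by (metis dvdE mult.commute)
  have "coprime r k"
  proof -
    define g where "g = gcd r k"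
    obtain k' where k': "k = g * k'" unfolding g_def by (meson dvdE gcd_dvd2)
    obtain r' where r': "r = g * r'" unfolding g_def by (meson dvdE gcd_dvd1)
    have "0 < g" "0 < k'" using k k' by auto
    have *: "totient m * k' = r' * m"
    proof -
      have "g * (totient m * k') = g * (r' * m)"
        using r unfolding k' r' by (simp add: ac_simps)
      with \<open>0 < g\<close> show ?thesis by simp
    qed
    have "euler_quotient m (n + int (k' * m)) = euler_quotient m n" for n
    proof (cases "coprime n (int m)")
      case True
      have "int (totient m) * n ^ (totient m - 1) * int k' = int (totient m * k') * n ^ (totient m - 1)"
        by simp
      also have "\<dots> = int m * (int r' * n ^ (totient m - 1))"
        unfolding * by simp
      finally have eq: "int (totient m) * n ^ (totient m - 1) * int k'
          = int m * (int r' * n ^ (totient m - 1))" .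
      have "euler_quotient m (n + int m * int k') = euler_quotient m n mod int m"
        unfolding euler_quotient_shift[OF assms(1) True] eq by simp
      also have "\<dots> = euler_quotient m n" by (simp add: euler_quotient_def)
      finally show ?thesis by (simp add: mult.commute)
    next
      case False
      moreover have "\<not> coprime (n + int (k' * m)) (int m)"
        using False by (simp add: coprime_add_multiple_iff)
      ultimately show ?thesis by (simp add: euler_quotient_not_coprime)
    qed
    then have "k * m \<le> k' * m"
      using assms(1,3) \<open>0 < k'\<close> unfolding least_period_def by (metis nat_0_less_mult_iff)
    then have "k \<le> k'" using assms(1) by simp
    then have "g * k' \<le> 1 * k'" using k' by linarith
    then have "g \<le> 1" using \<open>0 < k'\<close> by (simp only: mult_le_cancel2)
    then have "g = 1" using \<open>0 < g\<close> by simp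
    then show ?thesis unfolding g_def coprime_iff_gcd_eq_1 .
  qed
  with r that show ?thesis by blast
qed

section \<open>The correlation sum\<close>

lemma binary_sign_eq_square_wave:
  assumes "0 < m"
  shows "(- 1) ^ euler_binary_seq m t
    = square_wave (real_of_int (euler_quotient m (int t)) / real m)"
proof -
  define x where "x = real_of_int (euler_quotient m (int t)) / real m"
  have "0 \<le> euler_quotient m (int t)" "euler_quotient m (int t) < int m"
    using assms by (auto simp: euler_quotient_def)
  then have "0 \<le> real_of_int (euler_quotient m (int t))"
    "real_of_int (euler_quotient m (int t)) < real m" by linarith+
  then have "0 \<le> x" "x < 1" using assms by (simp_all add: x_def)
  then have "frac x = x" by (simp add: frac_eq)
  then show ?thesis by (simp add: euler_binary_seq_def square_wave_def flip: x_def)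
qed

definition correlation_term :: "nat \<Rightarrow> nat \<Rightarrow> real" where
  "correlation_term m t = (- 1) ^ (euler_binary_seq m t + euler_binary_seq m (t + m)
     + euler_binary_seq m (t + 2 * m) + euler_binary_seq m (t + 3 * m))"

lemma correlation_term_eq:
  "correlation_term m (t + l * m) = (- 1) ^ (euler_binary_seq m (t + l * m)
     + euler_binary_seq m (t + (l + 1) * m) + euler_binary_seq m (t + (l + 2) * m)
     + euler_binary_seq m (t + (l + 3) * m))"
proof -
  have "t + l * m + m = t + (l + 1) * m" "t + l * m + 2 * m = t + (l + 2) * m"
    "t + l * m + 3 * m = t + (l + 3) * m" by (simp_all add: algebra_simps)
  then show ?thesis unfolding correlation_term_def by (simp only:)
qed

lemma correlation_term_not_coprime:
  assumes "\<not> coprime t m"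
  shows "correlation_term m (t + l * m) = 1"
proof -
  have "euler_binary_seq m (t + j * m) = 0" for j
  proof -
    have "\<not> coprime (t + j * m) m"
      using assms by (simp add: coprime_add_multiple_iff)
    then have "\<not> coprime (int (t + j * m)) (int m)" by (simp only: coprime_int_iff not_False_eq_True)
    then have "euler_quotient m (int (t + j * m)) = 0" by (rule euler_quotient_not_coprime)
    then show ?thesis unfolding euler_binary_seq_def by (simp del: of_nat_add)
  qed
  then show ?thesis unfolding correlation_term_eq by (simp only: add_0_right power_0)
qed

text \<open>
  By \<open>euler_quotient_shift\<close> and \<open>\<phi> m / m = r / k\<close>, replacing \<open>t\<close> by \<open>t + j * m\<close> moves \<open>Q / m\<close> by
  \<open>c * j / k\<close> modulo 1, where \<open>c = r * t ^ (totient m - 1)\<close>. Reducing the numerators modulo \<open>k\<close> brings the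
  arguments into the form that the averaging lemmas expect.
\<close>

lemma correlation_term_coprime:
  assumes "0 < m" "0 < k" "totient m * k = r * m" "coprime t m"
  shows "correlation_term m (t + l * m)
    = fourfold (real_of_int (euler_quotient m (int t)) / real m
        + real ((r * t ^ (totient m - 1) * l) mod k) / real k)
      (real ((r * t ^ (totient m - 1)) mod k) / real k)"
proof -
  define x where "x = real_of_int (euler_quotient m (int t)) / real m"
  define c where "c = r * t ^ (totient m - 1)"
  have red: "real (a mod k) / real k = real a / real k + real_of_int (- int (a div k))" for a
  proof -
    have "real a = real k * real (a div k) + real (a mod k)"
      by (simp flip: of_nat_mult of_nat_add)
    then show ?thesis using assms(2) by (simp add: field_simps)
  qed
  have sign: "(- 1) ^ euler_binary_seq m (t + j * m) = square_wave (x + real (c * j) / real k)" for j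
  proof -
    define A where "A = euler_quotient m (int t) + int (totient m) * int t ^ (totient m - 1) * int j"
    have "euler_quotient m (int (t + j * m)) = A mod int m"
      using euler_quotient_shift[OF assms(1), of "int t" "int j"] assms(4)
      by (simp add: A_def mult.commute)
    also have "\<dots> = A - int m * (A div int m)" by (simp add: minus_mult_div_eq_mod)
    finally have "real_of_int (euler_quotient m (int (t + j * m))) / real m
        = real_of_int A / real m + real_of_int (- (A div int m))"
      using assms(1) by (simp add: diff_divide_distrib)
    moreover have "real_of_int A / real m = x + real (c * j) / real k"
    proof -
      have "real (totient m) * real k = real r * real m"
        using assms(3) by (simp flip: of_nat_mult)
      then have "real (totient m) / real m = real r / real k"
        using assms(1,2) by (simp add: field_simps)
      then have "real (totient m) / real m * (real t ^ (totient m - 1) * real j)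
          = real r / real k * (real t ^ (totient m - 1) * real j)" by simp
      then show ?thesis by (simp add: A_def x_def c_def add_divide_distrib ac_simps)
    qed
    ultimately show ?thesis
      unfolding binary_sign_eq_square_wave[OF assms(1)] by (simp only: square_wave_shift_int)
  qed
  have arg: "x + real (c * (l + i)) / real k = x + real (c * l) / real k + real i * (real c / real k)" for i
    by (simp add: algebra_simps add_divide_distrib)
  have "correlation_term m (t + l * m) = fourfold (x + real (c * l) / real k) (real c / real k)"
    unfolding correlation_term_eq power_add sign arg fourfold_def by simp
  also have "\<dots> = fourfold (x + real ((c * l) mod k) / real k) (real (c mod k) / real k)"
    unfolding red fourfold_step_int unfolding add.assoc[symmetric] fourfold_shift_int ..
  finally show ?thesis by (simp only: x_def c_def)
qed

text \<open>
  As \<open>c\<close> is coprime to \<open>k\<close>, the multiples \<open>c * l\<close> run through all residues modulo \<open>k\<close>, which turns the sum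
  over \<open>l\<close> into a sum over equally spaced points.
\<close>

lemma sum_correlation_term_coprime:
  assumes "0 < m" "0 < k" "totient m * k = r * m" "coprime r k" "k dvd m" "coprime t m"
  shows "\<bar>(\<Sum>l<k. correlation_term m (t + l * m))
    - real k * fourfold_mean (real ((r * t ^ (totient m - 1)) mod k) / real k)\<bar> \<le> 8"
proof -
  define x where "x = real_of_int (euler_quotient m (int t)) / real m"
  define c where "c = r * t ^ (totient m - 1)"
  have "coprime t k" using assms(5,6) coprime_divisors[OF dvd_refl] by blast
  then have c: "coprime c k" using assms(4) by (simp add: c_def)
  have "(\<Sum>l<k. correlation_term m (t + l * m))
      = (\<Sum>l<k. fourfold (x + real ((c * l) mod k) / real k) (real (c mod k) / real k))"
    using correlation_term_coprime[OF assms(1-3,6)] by (simp add: x_def c_def)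
  also have "\<dots> = (\<Sum>j<k. fourfold (x + real j / real k) (real (c mod k) / real k))"
    by (rule sum_reindex_mult_mod(1)[OF c assms(2)])
  finally show ?thesis
    using sum_fourfold[OF assms(2), of "real (c mod k) / real k" x] assms(2) by (simp add: c_def)
qed

text \<open>
  The sum splits into the contribution of the non-units, the total deviation \<open>D\<close> of the inner sums
  from their means, and the deviation \<open>V\<close> of these means from \<open>1/3\<close>.
\<close>

lemma correlation_bound:
  assumes "odd m" "3 < k" "k dvd m" "least_period (euler_quotient m) (k * m)"
  shows "\<bar>(\<Sum>t<k * m. correlation_term m t) - (real (k * m) - 2 / 3 * real k * real (totient m))\<bar>
    \<le> 300 * (real (totient m) / real (totient k) * real k powr (3 / 2))"
proof -
  have m: "0 < m" using assms(1) by (rule odd_pos)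
  have "k \<le> m" using dvd_imp_le[OF assms(3) m] .
  with assms(2) have m1: "1 < m" and k: "0 < k" "1 < k" by simp_all
  obtain r where r: "totient m * k = r * m" "coprime r k"
    using euler_quotient_step[OF m assms(3,4)] by blast
  define U where "U = units_below m"
  have U: "finite U" "U \<subseteq> {..<m}" "real (card U) = real (totient m)"
    using card_units_below[OF m1] by (auto simp: U_def units_below_def)
  define B where "B t = (\<Sum>l<k. correlation_term m (t + l * m))" for t
  define c where "c t = (r * t ^ (totient m - 1)) mod k" for t
  have "(\<Sum>t<k * m. correlation_term m t) = (\<Sum>l<k. \<Sum>t\<in>{l * m..<l * m + m}. correlation_term m t)"
    by (simp add: sum.nat_group)
  also have "\<dots> = (\<Sum>l<k. \<Sum>t<m. correlation_term m (t + l * m))"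
  proof (rule sum.cong[OF refl])
    show "(\<Sum>t\<in>{l * m..<l * m + m}. correlation_term m t) = (\<Sum>t<m. correlation_term m (t + l * m))" for l
      using sum.shift_bounds_nat_ivl[of "correlation_term m" 0 "l * m" m]
      by (simp add: add.commute lessThan_atLeast0)
  qed
  also have "\<dots> = (\<Sum>t<m. B t)" unfolding B_def by (rule sum.swap)
  also have "\<dots> = (\<Sum>t\<in>{..<m} - U. B t) + (\<Sum>t\<in>U. B t)"
    using U by (intro sum.subset_diff) auto
  also have "(\<Sum>t\<in>{..<m} - U. B t) = (\<Sum>t\<in>{..<m} - U. real k)"
    unfolding B_def U_def units_below_def
    by (intro sum.cong refl) (simp add: correlation_term_not_coprime)
  also have "\<dots> = real k * (real m - real (totient m))"
    using U m1 by (simp add: card_Diff_subset of_nat_diff totient_le card_units_below U_def)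
  finally have total: "(\<Sum>t<k * m. correlation_term m t)
      = real k * (real m - real (totient m)) + (\<Sum>t\<in>U. B t)" .
  define V where "V = (\<Sum>t\<in>U. fourfold_mean (real (c t) / real k) - 1/3)"
  define D where "D = (\<Sum>t\<in>U. B t - real k * fourfold_mean (real (c t) / real k))"
  have "(\<Sum>t\<in>U. B t) = D + real k * V + real k * real (totient m) / 3"
    using U(3) unfolding D_def V_def
    by (simp add: sum_subtractf sum_distrib_left right_diff_distrib)
  with total have eq: "(\<Sum>t<k * m. correlation_term m t)
      - (real (k * m) - 2 / 3 * real k * real (totient m)) = D + real k * V"
    by (simp add: algebra_simps)
  have "\<bar>D\<bar> \<le> (\<Sum>t\<in>U. 8)"
    unfolding D_def
  proof (rule order_trans[OF sum_abs sum_mono])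
    fix t assume "t \<in> U"
    then show "\<bar>B t - real k * fourfold_mean (real (c t) / real k)\<bar> \<le> 8"
      using sum_correlation_term_coprime[OF m k(1) r assms(3)]
      by (simp add: B_def c_def U_def units_below_def)
  qed
  then have D: "\<bar>D\<bar> \<le> 8 * real (totient m)" using U(3) by simp
  have "real (totient k) * V = real (totient m) * (\<Sum>a\<in>units_below k. fourfold_mean (real a / real k) - 1/3)"
    unfolding V_def U_def c_def
    using sum_units_quotient[OF assms(3) k(2) m r(2), of "\<lambda>a. fourfold_mean (real a / real k) - 1/3"] .
  moreover have "odd k" using assms(1,3) by (meson dvd_trans)
  then have "\<bar>\<Sum>a\<in>units_below k. fourfold_mean (real a / real k) - 1/3\<bar> \<le> 184 * sqrt (2 * real k)"
    using sum_units_bound[of "\<lambda>y. fourfold_mean y - 1/3" 184 k] sum_fourfold_mean by blast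
  then have "real (totient m) * \<bar>\<Sum>a\<in>units_below k. fourfold_mean (real a / real k) - 1/3\<bar>
      \<le> real (totient m) * (184 * sqrt (2 * real k))"
    by (rule mult_left_mono) simp
  moreover have "real (totient k) * \<bar>V\<bar> = \<bar>real (totient k) * V\<bar>"
    by (simp add: abs_mult)
  ultimately have "real (totient k) * \<bar>V\<bar> \<le> real (totient m) * (184 * sqrt (2 * real k))"
    by (simp add: abs_mult)
  then have V: "\<bar>V\<bar> \<le> real (totient m) / real (totient k) * (184 * sqrt (2 * real k))"
    using k by (simp add: field_simps)
  \<comment> \<open>The constant 300 leaves room for \<open>8 + 184 * sqrt 2 \<le> 8 + 184 * (3 / 2) = 284\<close>.\<close>
  define X where "X = real (totient m) / real (totient k) * (real k * sqrt (real k))"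
  have powr: "real k powr (3/2) = real k * sqrt (real k)"
    using k powr_add[of "real k" 1 "1/2"] by (simp add: powr_half_sqrt)
  have "sqrt 2 \<le> 3 / (2 :: real)" by (rule real_le_lsqrt) (simp_all add: power2_eq_square)
  then have "184 * (sqrt 2 * X) \<le> 184 * (3 / 2 * X)"
    by (intro mult_left_mono mult_right_mono) (simp_all add: X_def)
  moreover have "real k * \<bar>V\<bar> \<le> 184 * (sqrt 2 * X)"
    using mult_left_mono[OF V, of "real k"] by (simp add: X_def real_sqrt_mult ac_simps)
  moreover have "real (totient m) \<le> X"
  proof -
    have "real (totient k) * 1 \<le> real k * sqrt (real k)"
      using k totient_le[of k] by (intro mult_mono) auto
    then have "real (totient m) * real (totient k) \<le> real (totient m) * (real k * sqrt (real k))"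
      by (intro mult_left_mono) simp_all
    then show ?thesis using k by (simp add: X_def pos_le_divide_eq)
  qed
  moreover have "\<bar>D + real k * V\<bar> \<le> \<bar>D\<bar> + real k * \<bar>V\<bar>"
    using abs_triangle_ineq[of D "real k * V"] by (simp add: abs_mult)
  ultimately show ?thesis using D unfolding eq powr X_def[symmetric] by linarith
qed

theorem theorem1:
  shows "\<exists>C::real. \<forall>m k :: nat.
    m \<ge> 2 \<and> odd m \<and> k > 3 \<and> k dvd m \<and> least_period (euler_quotient m) (k * m) \<longrightarrow>
      \<bar>(\<Sum>t = 0..<k * m. (- 1) ^ (euler_binary_seq m t + euler_binary_seq m (t + m)
                              + euler_binary_seq m (t + 2 * m) + euler_binary_seq m (t + 3 * m)))
        - (real (k * m) - 2 / 3 * real k * real (totient m))\<bar>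
      \<le> C * (real (totient m) / real (totient k) * real k powr (3 / 2) * ln (real m) ^ 4)"
proof (intro exI[of _ 300] allI impI, elim conjE)
  fix m k :: nat
  assume *: "odd m" "3 < k" "k dvd m" "least_period (euler_quotient m) (k * m)"
  define Y where "Y = real (totient m) / real (totient k) * real k powr (3 / 2)"
  have "0 < m" using *(1) by (rule odd_pos)
  then have "3 \<le> m" using *(2) dvd_imp_le[OF *(3)] by simp
  then have "exp 1 \<le> real m" using exp_le by linarith
  then have "1 \<le> ln (real m)" using \<open>0 < m\<close> by (simp add: ln_ge_iff)
  then have "1 \<le> ln (real m) ^ 4" by (rule one_le_power)
  moreover have "0 \<le> Y" by (simp add: Y_def)
  ultimately have "300 * (Y * 1) \<le> 300 * (Y * ln (real m) ^ 4)"
    by (intro mult_left_mono) simp_all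
  then have "\<bar>(\<Sum>t<k * m. correlation_term m t)
      - (real (k * m) - 2 / 3 * real k * real (totient m))\<bar> \<le> 300 * (Y * ln (real m) ^ 4)"
    using correlation_bound[OF *] unfolding Y_def by linarith
  then show "\<bar>(\<Sum>t = 0..<k * m. (- 1) ^ (euler_binary_seq m t + euler_binary_seq m (t + m)
                              + euler_binary_seq m (t + 2 * m) + euler_binary_seq m (t + 3 * m)))
        - (real (k * m) - 2 / 3 * real k * real (totient m))\<bar>
      \<le> 300 * (real (totient m) / real (totient k) * real k powr (3 / 2) * ln (real m) ^ 4)"
    unfolding Y_def correlation_term_def lessThan_atLeast0 .
qed

end
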